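(* Let $M = (Q, \Sigma, \Gamma, \delta, q_0, F)$ be a checking stack automaton (CSA). Then its weak space complexity $\sigma^{\rm w}_M(n)$ is in $O(n)$.
   Context: **Stack automata.** A one-way nondeterministic stack automaton (SA) is a 6-tuple $M=(Q,\Sigma,\Gamma,\delta,q_0,F)$: $Q$ is a finite set of states; $\Sigma,\Gamma$ are the (finite) input and stack alphabets; $\Gamma$ contains two special symbols $\triangleright$ (bottom marker) and $\triangleleft$ (top marker), and $\Gamma_0=\Gamma\setminus\{\triangleright,\triangleleft\}$; $q_0\in Q$ is the initial state; $F\subseteq Q$ is the set of final states; $\delta$ is a nondeterministic transition function from $Q\times(\Sigma\cup\{\lambda\})\times\Gamma$ into subsets of $Q\times\{\mathtt{stay},\mathtt{push}(x),\mathtt{pop},-1,0,+1 \mid x\in\Gamma_0\}$ ($\lambda$ is the empty word). Write $(q,a,y)\to(p,\iota)$ for $(p,\iota)\in\delta(q,a,y)$. A configuration is a triple $c=(q,w,\gamma)$ with $q\in Q$ the current state, $w\in\Sigma^*$ the remaining input, and $\gamma\in \triangleright\Gamma_0^*\uparrow\Gamma_0^*\triangleleft$ or $\gamma\in\triangleright\Gamma_0^*\triangleleft\uparrow$, where $\uparrow\notin\Gamma$ marks the stack head, which scans the symbol directly preceding it. The stack size of $c$ is $\|c\|_\Gamma=|\gamma|-3$ (number of symbols of $\Gamma_0$ on the stack). Write relation $\vdash_w$: if $(q,a,x)\to(p,\iota)$ with $x\in\Gamma_0\cup\{\triangleright\}$, $a\in\Sigma\cup\{\lambda\}$, then for $u\in\Sigma^*$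 and $\gamma x\triangleleft\in\triangleright\Gamma_0^*\triangleleft$: $(q,au,\gamma x\uparrow\triangleleft)\vdash_w(p,u,\gamma x\uparrow\triangleleft)$ if $\iota=\mathtt{stay}$; $(q,au,\gamma x\uparrow\triangleleft)\vdash_w(p,u,\gamma xy\uparrow\triangleleft)$ if $\iota=\mathtt{push}(y)$; $(q,au,\gamma x\uparrow\triangleleft)\vdash_w(p,u,\gamma\uparrow\triangleleft)$ if $\iota=\mathtt{pop}$ and $x\ne\triangleright$. (These moves are undefined if the head is not at the topmost stack symbol.) Read relation $\vdash_r$: if $(q,a,x)\to(p,\iota)$ with $x\in\Gamma$, then for $u\in\Sigma^*$ and $\gamma_1x\gamma_2\in\triangleright\Gamma_0^*\triangleleft$: $(q,au,\gamma_1x\uparrow\gamma_2)\vdash_r(p,u,\gamma_1\uparrow x\gamma_2)$ if $\iota=-1$ and $x\neq\triangleright$; $(q,au,\gamma_1x\uparrow\gamma_2)\vdash_r(p,u,\gamma_1x\uparrow\gamma_2)$ if $\iota=0$; $(q,au,\gamma_1x\uparrow\gamma_2)\vdash_r(p,u,\gamma_1xy\uparrow\gamma_2')$ if $\iota=+1$ and $\gamma_2=y\gamma_2'$, $y\in\Gamma$. Let $\vdash=\vdash_w\cup\vdash_r$. A partial computation on $u\in\Sigma^*$ is a finite sequence of configurations $c_0\vdash\cdots\vdash c_m$ with $c_0=(q_0,u,\triangleright\uparrow\triangleleft)$. It is a computation if the remaining input in $c_m$ is $\lambda$, and an accepting computation if moreover the state of $c_m$ is in $F$. Its stack size is $\|\mathcal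 C\|_\Gamma=\max_j\|c_j\|_\Gamma$. The accepted language $L(M)$ is the set of words on which $M$ has an accepting computation. An SA has partitioned states if $Q$ is a disjoint union $Q_w\cup Q_r$ (write states and read states), $F\subseteq Q_r$, all transitions from states in $Q_w$ have $\iota\in\{\mathtt{stay},\mathtt{push}(x),\mathtt{pop}\}$ and all transitions from states in $Q_r$ have $\iota\in\{-1,0,+1\}$. An SA is non-erasing (NESA) if it has no $\mathtt{pop}$ transitions. A checking stack automaton (CSA) is a NESA with partitioned states and with no transitions from a read state to a write state. **Weak space measure.** For $u\in\Sigma^*$, $\sigma^{\rm w}_M(u)$ is the minimum of $\|\mathcal C\|_\Gamma$ over accepting computations $\mathcal C$ of $M$ on $u$ if $u\in L(M)$, and $0$ if $u\notin L(M)$. For $n\in\mathbb{N}$, $\sigma^{\rm w}_M(n)=\max\{\sigma^{\rm w}_M(u)\mid u\in\Sigma^*, |u|=n\}$. *)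

theory Defs
  imports Complex_Main "HOL-Library.Landau_Symbols"
begin

text \<open>\<open>Down\<close>, \<open>Same\<close>, \<open>Up\<close> are the read instructions -1, 0, +1. \<open>Same\<close> is distinct from
  the write instruction \<open>Stay\<close>.\<close>

datatype 'g instr = Stay | Push 'g | Pop | Down | Same | Up

record ('q, 'a, 'g) sa =
  states :: "'q set"
  input_alph :: "'a set"
  stack_alph :: "'g set"
  bottom :: 'g
  top_mark :: 'g
  delta :: "'q \<Rightarrow> 'a option \<Rightarrow> 'g \<Rightarrow> ('q \<times> 'g instr) set"
  init_state :: 'q
  final_states :: "'q set"

definition inner_alph :: "('q, 'a, 'g) sa \<Rightarrow> 'g set" where
  "inner_alph M = stack_alph M - {bottom M, top_mark M}"

definition instrs :: "('q, 'a, 'g) sa \<Rightarrow> 'g instr set" where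
  "instrs M = {Stay, Pop, Down, Same, Up} \<union> Push ` inner_alph M"

text \<open>In the second argument of \<open>delta\<close>, \<open>None\<close> is the empty word. \<open>delta\<close> is meaningful only on
  \<open>Q \<times> (\<Sigma> \<union> {\<lambda>}) \<times> \<Gamma>\<close>; its values elsewhere are ignored by \<open>transition\<close>.\<close>

definition input_opt :: "('q, 'a, 'g) sa \<Rightarrow> 'a option set" where
  "input_opt M = insert None (Some ` input_alph M)"

definition stack_automaton :: "('q, 'a, 'g) sa \<Rightarrow> bool" where
  "stack_automaton M \<longleftrightarrow>
     finite (states M) \<and> finite (input_alph M) \<and> finite (stack_alph M) \<and>
     bottom M \<in> stack_alph M \<and> top_mark M \<in> stack_alph M \<and> bottom M \<noteq> top_mark M \<and>
     init_state M \<in> states M \<and> final_states M \<subseteq> states M \<and>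
     (\<forall>q \<in> states M. \<forall>a \<in> input_opt M. \<forall>y \<in> stack_alph M.
        delta M q a y \<subseteq> states M \<times> instrs M)"

definition transition ::
  "('q, 'a, 'g) sa \<Rightarrow> 'q \<Rightarrow> 'a option \<Rightarrow> 'g \<Rightarrow> 'q \<Rightarrow> 'g instr \<Rightarrow> bool" where
  "transition M q a y p i \<longleftrightarrow>
     q \<in> states M \<and> a \<in> input_opt M \<and> y \<in> stack_alph M \<and> (p, i) \<in> delta M q a y"

text \<open>A configuration \<open>(q, w, l, r)\<close> represents state \<open>q\<close>, remaining input \<open>w\<close> and stack
  \<open>l\<up>r\<close>: the head scans the last symbol of \<open>l\<close>.\<close>

type_synonym ('q, 'a, 'g) config = "'q \<times> 'a list \<times> 'g list \<times> 'g list"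

definition stacks :: "('q, 'a, 'g) sa \<Rightarrow> 'g list set" where
  "stacks M = {bottom M # s @ [top_mark M] | s. s \<in> lists (inner_alph M)}"

definition configs :: "('q, 'a, 'g) sa \<Rightarrow> ('q, 'a, 'g) config set" where
  "configs M = {(q, w, l, r). q \<in> states M \<and> w \<in> lists (input_alph M) \<and> l \<noteq> [] \<and> l @ r \<in> stacks M}"

text \<open>The encoded string \<open>l\<up>r\<close> has length \<open>length l + length r + 1\<close>, and the stack size is that
  length minus 3.\<close>

fun stack_size :: "('q, 'a, 'g) config \<Rightarrow> nat" where
  "stack_size (q, w, l, r) = length l + length r - 2"

fun word_of :: "'a option \<Rightarrow> 'a list" where
  "word_of None = []"
| "word_of (Some a) = [a]"

inductive write_step ::
  "('q, 'a, 'g) sa \<Rightarrow> ('q, 'a, 'g) config \<Rightarrow> ('q, 'a, 'g) config \<Rightarrow> bool" for M where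
  stay: "\<lbrakk>transition M q a x p Stay; x \<in> inner_alph M \<union> {bottom M};
      u \<in> lists (input_alph M); \<gamma> @ [x, top_mark M] \<in> stacks M\<rbrakk>
    \<Longrightarrow> write_step M (q, word_of a @ u, \<gamma> @ [x], [top_mark M]) (p, u, \<gamma> @ [x], [top_mark M])"
| push: "\<lbrakk>transition M q a x p (Push y); x \<in> inner_alph M \<union> {bottom M};
      u \<in> lists (input_alph M); \<gamma> @ [x, top_mark M] \<in> stacks M\<rbrakk>
    \<Longrightarrow> write_step M (q, word_of a @ u, \<gamma> @ [x], [top_mark M]) (p, u, \<gamma> @ [x, y], [top_mark M])"
| pop: "\<lbrakk>transition M q a x p Pop; x \<in> inner_alph M \<union> {bottom M};
      u \<in> lists (input_alph M); \<gamma> @ [x, top_mark M] \<in> stacks M; x \<noteq> bottom M\<rbrakk>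
    \<Longrightarrow> write_step M (q, word_of a @ u, \<gamma> @ [x], [top_mark M]) (p, u, \<gamma>, [top_mark M])"

inductive read_step ::
  "('q, 'a, 'g) sa \<Rightarrow> ('q, 'a, 'g) config \<Rightarrow> ('q, 'a, 'g) config \<Rightarrow> bool" for M where
  down: "\<lbrakk>transition M q a x p Down; u \<in> lists (input_alph M);
      \<gamma>1 @ [x] @ \<gamma>2 \<in> stacks M; x \<noteq> bottom M\<rbrakk>
    \<Longrightarrow> read_step M (q, word_of a @ u, \<gamma>1 @ [x], \<gamma>2) (p, u, \<gamma>1, x # \<gamma>2)"
| same: "\<lbrakk>transition M q a x p Same; u \<in> lists (input_alph M); \<gamma>1 @ [x] @ \<gamma>2 \<in> stacks M\<rbrakk>
    \<Longrightarrow> read_step M (q, word_of a @ u, \<gamma>1 @ [x], \<gamma>2) (p, u, \<gamma>1 @ [x], \<gamma>2)"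
| up: "\<lbrakk>transition M q a x p Up; u \<in> lists (input_alph M);
      \<gamma>1 @ [x] @ y # \<gamma>2 \<in> stacks M\<rbrakk>
    \<Longrightarrow> read_step M (q, word_of a @ u, \<gamma>1 @ [x], y # \<gamma>2) (p, u, \<gamma>1 @ [x, y], \<gamma>2)"

definition step ::
  "('q, 'a, 'g) sa \<Rightarrow> ('q, 'a, 'g) config \<Rightarrow> ('q, 'a, 'g) config \<Rightarrow> bool" where
  "step M c c' \<longleftrightarrow> write_step M c c' \<or> read_step M c c'"

definition partial_computation ::
  "('q, 'a, 'g) sa \<Rightarrow> 'a list \<Rightarrow> ('q, 'a, 'g) config list \<Rightarrow> bool" where
  "partial_computation M u C \<longleftrightarrow>
     C \<noteq> [] \<and> set C \<subseteq> configs M \<and> hd C = (init_state M, u, [bottom M], [top_mark M]) \<and>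
     successively (step M) C"

definition computation ::
  "('q, 'a, 'g) sa \<Rightarrow> 'a list \<Rightarrow> ('q, 'a, 'g) config list \<Rightarrow> bool" where
  "computation M u C \<longleftrightarrow> partial_computation M u C \<and> fst (snd (last C)) = []"

definition accepting_computation ::
  "('q, 'a, 'g) sa \<Rightarrow> 'a list \<Rightarrow> ('q, 'a, 'g) config list \<Rightarrow> bool" where
  "accepting_computation M u C \<longleftrightarrow> computation M u C \<and> fst (last C) \<in> final_states M"

definition computation_size :: "('q, 'a, 'g) config list \<Rightarrow> nat" where
  "computation_size C = (MAX c \<in> set C. stack_size c)"

definition lang :: "('q, 'a, 'g) sa \<Rightarrow> 'a list set" where
  "lang M = {u \<in> lists (input_alph M). \<exists>C. accepting_computation M u C}"

definition partitioned_by :: "('q, 'a, 'g) sa \<Rightarrow> 'q set \<Rightarrow> 'q set \<Rightarrow> bool" where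
  "partitioned_by M Qw Qr \<longleftrightarrow>
     states M = Qw \<union> Qr \<and> Qw \<inter> Qr = {} \<and> final_states M \<subseteq> Qr \<and>
     (\<forall>q a y p i. transition M q a y p i \<longrightarrow> q \<in> Qw \<longrightarrow> i \<in> {Stay, Pop} \<union> range Push) \<and>
     (\<forall>q a y p i. transition M q a y p i \<longrightarrow> q \<in> Qr \<longrightarrow> i \<in> {Down, Same, Up})"

definition nonerasing :: "('q, 'a, 'g) sa \<Rightarrow> bool" where
  "nonerasing M \<longleftrightarrow> (\<forall>q a y p. \<not> transition M q a y p Pop)"

definition checking_stack_automaton :: "('q, 'a, 'g) sa \<Rightarrow> bool" where
  "checking_stack_automaton M \<longleftrightarrow>
     stack_automaton M \<and> nonerasing M \<and>
     (\<exists>Qw Qr. partitioned_by M Qw Qr \<and>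
        (\<forall>q a y p i. transition M q a y p i \<longrightarrow> q \<in> Qr \<longrightarrow> p \<notin> Qw))"

definition weak_space_word :: "('q, 'a, 'g) sa \<Rightarrow> 'a list \<Rightarrow> nat" where
  "weak_space_word M u =
     (if u \<in> lang M
      then (LEAST s. \<exists>C. accepting_computation M u C \<and> s = computation_size C)
      else 0)"

text \<open>The supremum is a maximum, since there are finitely many words of length \<open>n\<close>. It is
  \<open>0\<close> in the degenerate case of an empty input alphabet and \<open>n > 0\<close>.\<close>

definition weak_space :: "('q, 'a, 'g) sa \<Rightarrow> nat \<Rightarrow> nat" where
  "weak_space M n = (SUP u \<in> {u \<in> lists (input_alph M). length u = n}. weak_space_word M u)"

lemma weak_space_eq_Max:
  assumes "stack_automaton M" "input_alph M \<noteq> {} \<or> n = 0"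
  shows "weak_space M n = Max (weak_space_word M ` {u \<in> lists (input_alph M). length u = n})"
proof -
  let ?W = "{u \<in> lists (input_alph M). length u = n}"
  have "finite (input_alph M)"
    using assms(1) by (simp add: stack_automaton_def)
  then have "finite {u. set u \<subseteq> input_alph M \<and> length u = n}"
    by (rule finite_lists_length_eq)
  then have fin: "finite ?W"
    by (rule rev_finite_subset) auto
  have "?W \<noteq> {}"
  proof (cases "n = 0")
    case True
    then show ?thesis by auto
  next
    case False
    with assms(2) obtain a where "a \<in> input_alph M" by blast
    then have "replicate n a \<in> ?W" by (auto simp: in_lists_conv_set)
    then show ?thesis by blast
  qed
  with fin show ?thesis
    unfolding weak_space_def by (intro cSup_eq_Max) auto
qed

end

theory Submission imports Defs "HOL-Library.FuncSet" begin

text \<open>An accepting run first writes a stack word \<open>s\<close> and then only reads it. Call a stack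
  position special if the read phase consumes input there, starts there or ends there; an input of
  length \<open>n\<close> gives at most \<open>n + 2\<close> special positions. If \<open>s\<close> is longer than a constant times
  \<open>n + 3\<close>, it has a long stretch without special positions during whose writing no input is
  consumed either. After each symbol of the stretch record the write state, the top symbol and the
  behaviour of the part of the stretch written so far, as a relation between the ways in which the
  read head enters and leaves it. There are finitely many such records, so one of them occurs twice,
  and the segment between the two occurrences can be cut out. Hence shortest accepted stack words
  have length \<open>O(n)\<close>.\<close>

section \<open>Abstract runs of the two phases and the behaviour of a block\<close>

locale csa =
  fixes M :: "('q, 'a, 'g) sa"
  assumes csa: "checking_stack_automaton M"
begin

lemma sa: "stack_automaton M" and no_pop: "\<not> transition M q a y p Pop"
  using csa by (auto simp: checking_stack_automaton_def nonerasing_def)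

lemma transition_target:
  assumes "transition M q a y p i"
  shows "p \<in> states M" "i \<in> instrs M"
  using assms sa unfolding transition_def stack_automaton_def by blast+

lemma stacks_iff: "bottom M # s @ [top_mark M] \<in> stacks M \<longleftrightarrow> set s \<subseteq> inner_alph M"
  by (auto simp: stacks_def)

lemma markers_not_inner [simp]: "bottom M \<notin> inner_alph M" "top_mark M \<notin> inner_alph M"
  by (auto simp: inner_alph_def)

lemma markers_distinct [simp]: "bottom M \<noteq> top_mark M" "top_mark M \<noteq> bottom M"
  using sa by (auto simp: stack_automaton_def)

text \<open>During writing the head is always on top, so the inner stack word \<open>s\<close>
  determines the stack; for empty \<open>s\<close> the scanned symbol is the bottom marker. By
  \<open>no_pop\<close> only two kinds of moves occur.\<close>

inductive wr :: "'q \<times> 'a list \<times> 'g list \<Rightarrow> 'q \<times> 'a list \<times> 'g list \<Rightarrow> bool" where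
  stay: "\<lbrakk>transition M q a (last (bottom M # s)) p Stay; v \<in> lists (input_alph M)\<rbrakk>
    \<Longrightarrow> wr (q, word_of a @ v, s) (p, v, s)"
| push: "\<lbrakk>transition M q a (last (bottom M # s)) p (Push y); v \<in> lists (input_alph M)\<rbrakk>
    \<Longrightarrow> wr (q, word_of a @ v, s) (p, v, s @ [y])"

definition shift :: "'g instr \<Rightarrow> nat \<Rightarrow> nat \<Rightarrow> bool" where
  "shift i k k' \<longleftrightarrow> i = Down \<and> k = Suc k' \<or> i = Same \<and> k' = k \<or> i = Up \<and> k' = Suc k"

text \<open>Read moves on the fixed tape \<open>w\<close> with head position \<open>k\<close>, where input may only be consumed
  at positions in \<open>S\<close>.\<close>

inductive rd :: "nat set \<Rightarrow> 'g list \<Rightarrow> 'q \<times> 'a list \<times> nat \<Rightarrow> 'q \<times> 'a list \<times> nat \<Rightarrow> bool"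
  for S w where
  "\<lbrakk>transition M q a (w ! k) p i; shift i k k'; k < length w; k' < length w;
     v \<in> lists (input_alph M); a = None \<or> k \<in> S\<rbrakk>
    \<Longrightarrow> rd S w (q, word_of a @ v, k) (p, v, k')"

text \<open>Moves without input inside a block \<open>t\<close>, whose cells have positions \<open>1, \<dots>, length t\<close>;
  the positions \<open>0\<close> and \<open>length t + 1\<close> mean that the head has left the block.\<close>

inductive lstep :: "'g list \<Rightarrow> 'q \<times> nat \<Rightarrow> 'q \<times> nat \<Rightarrow> bool" for t where
  "\<lbrakk>transition M q None (t ! j) p i; shift i (Suc j) k; j < length t\<rbrakk>
    \<Longrightarrow> lstep t (q, Suc j) (p, k)"

text \<open>The flag \<open>True\<close> is the upper end of the block and \<open>False\<close> the
  lower end; entering puts the head on the end cell, leaving on the position just outside.\<close>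

definition entry :: "'g list \<Rightarrow> bool \<Rightarrow> nat" where
  "entry t d = (if d then length t else 1)"

definition exit :: "'g list \<Rightarrow> bool \<Rightarrow> nat" where
  "exit t d = (if d then Suc (length t) else 0)"

text \<open>This is the crossing table known from two-way finite automata, restricted to moves
  without input. Restricting to \<open>states M\<close> leaves finitely many possible
  values.\<close>

definition beh :: "'g list \<Rightarrow> (bool \<times> 'q \<times> bool \<times> 'q) set" where
  "beh t = {(d, q, d', p). q \<in> states M \<and> (lstep t)\<^sup>*\<^sup>* (q, entry t d) (p, exit t d')}"

lemma beh_subset: "beh t \<subseteq> UNIV \<times> states M \<times> UNIV \<times> states M"
proof -
  have "fst c' \<in> states M" if "(lstep t)\<^sup>*\<^sup>* c c'" "fst c \<in> states M" for c c'
    using that by induction (auto elim!: lstep.cases dest: transition_target)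
  then show ?thesis unfolding beh_def by fastforce
qed

subsection \<open>The write phase\<close>

text \<open>Without \<open>Pop\<close> a run never uncovers what lies below its starting top symbol,
  so the same moves work on any stack with that top symbol.\<close>

lemma wr_append:
  assumes "wr\<^sup>*\<^sup>* (q, u, s) (p, v, s')"
  shows "\<exists>d. s' = s @ d \<and>
    (\<forall>z. last (bottom M # z) = last (bottom M # s) \<longrightarrow> wr\<^sup>*\<^sup>* (q, u, z) (p, v, z @ d))"
  using assms
proof (induction "(p, v, s')" arbitrary: p v s')
  case base
  then show ?case by auto
next
  case (step c)
  obtain p1 v1 s1 where c: "c = (p1, v1, s1)" by (cases c)
  from step.hyps(3)[OF c] obtain d where d: "s1 = s @ d"
    "\<And>z. last (bottom M # z) = last (bottom M # s) \<Longrightarrow> wr\<^sup>*\<^sup>* (q, u, z) (p1, v1, z @ d)" by blast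
  have lst: "last (bottom M # z @ d) = last (bottom M # s1)"
    if "last (bottom M # z) = last (bottom M # s)" for z
    using that d(1) by (cases "d = []") auto
  from step.hyps(2)[unfolded c] show ?case
  proof cases
    case (stay a)
    have "wr (p1, v1, z @ d) (p, v, z @ d)" if "last (bottom M # z) = last (bottom M # s)" for z
      using wr.stay[of p1 a "z @ d" p v] stay lst[OF that] by simp
    with d stay show ?thesis by (metis rtranclp.rtrancl_into_rtrancl)
  next
    case (push a y)
    have "wr (p1, v1, z @ d) (p, v, z @ d @ [y])"
      if "last (bottom M # z) = last (bottom M # s)" for z
      using wr.push[of p1 a "z @ d" p y v] push lst[OF that] by simp
    then have "wr\<^sup>*\<^sup>* (q, u, z) (p, v, z @ d @ [y])"
      if "last (bottom M # z) = last (bottom M # s)" for z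
      using d(2)[OF that] that by (blast intro: rtranclp.rtrancl_into_rtrancl)
    moreover have "s' = s @ d @ [y]" using d(1) push by simp
    ultimately show ?thesis by blast
  qed
qed

lemma wr_invariants:
  assumes "wr\<^sup>*\<^sup>* (q, u, s) (p, v, s')"
  shows "\<exists>x. u = x @ v" "q \<in> states M \<Longrightarrow> p \<in> states M"
    "set s \<subseteq> inner_alph M \<Longrightarrow> set s' \<subseteq> inner_alph M"
proof -
  have "(\<exists>x. u = x @ v) \<and> (q \<in> states M \<longrightarrow> p \<in> states M) \<and>
    (set s \<subseteq> inner_alph M \<longrightarrow> set s' \<subseteq> inner_alph M)"
    using assms
  proof (induction "(p, v, s')" arbitrary: p v s')
    case (step c)
    from step.hyps(2) show ?case
    proof cases
      case (stay q' a)
      with step.hyps(3)[OF stay(1)] show ?thesis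
        by (auto dest: transition_target)
    next
      case (push q' a s'' y)
      with step.hyps(3)[OF push(1)] transition_target[OF push(3)] show ?thesis
        by (auto simp: instrs_def)
    qed
  qed auto
  then show "\<exists>x. u = x @ v" "q \<in> states M \<Longrightarrow> p \<in> states M"
    "set s \<subseteq> inner_alph M \<Longrightarrow> set s' \<subseteq> inner_alph M" by auto
qed

text \<open>A push raises the height by one and nothing is erased, so the run passes through every
  height \<open>h\<close>, where its stack is \<open>take h s\<close>. The functions
  \<open>Q\<close> and \<open>U\<close> select one configuration per height, all from this
  run.\<close>

lemma wr_heights:
  assumes "wr\<^sup>*\<^sup>* (q, u, []) (p, v, s)"
  shows "\<exists>Q U. (\<forall>h \<le> length s. wr\<^sup>*\<^sup>* (q, u, []) (Q h, U h, take h s)) \<and>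
    (\<forall>i j. i \<le> j \<longrightarrow> j \<le> length s \<longrightarrow> wr\<^sup>*\<^sup>* (Q i, U i, take i s) (Q j, U j, take j s)) \<and>
    (\<forall>h \<le> length s. wr\<^sup>*\<^sup>* (Q h, U h, take h s) (p, v, s))"
  using assms
proof (induction "(p, v, s)" arbitrary: p v s)
  case base
  show ?case by (rule exI[of _ "\<lambda>_. q"], rule exI[of _ "\<lambda>_. u"]) (use base in auto)
next
  case (step c)
  obtain p1 v1 s1 where c: "c = (p1, v1, s1)" by (cases c)
  from step.hyps(3)[OF c] obtain Q U where
    A: "\<And>h. h \<le> length s1 \<Longrightarrow> wr\<^sup>*\<^sup>* (q, u, []) (Q h, U h, take h s1)" and
    B: "\<And>i j. i \<le> j \<Longrightarrow> j \<le> length s1 \<Longrightarrow> wr\<^sup>*\<^sup>* (Q i, U i, take i s1) (Q j, U j, take j s1)" and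
    C: "\<And>h. h \<le> length s1 \<Longrightarrow> wr\<^sup>*\<^sup>* (Q h, U h, take h s1) (p1, v1, s1)" by blast
  note st = step.hyps(2)[unfolded c]
  have run: "wr\<^sup>*\<^sup>* (q, u, []) (p, v, s)"
    using step.hyps(1) step.hyps(2) by (rule rtranclp.rtrancl_into_rtrancl)
  have C': "wr\<^sup>*\<^sup>* (Q h, U h, take h s1) (p, v, s)" if "h \<le> length s1" for h
    using C[OF that] st by (rule rtranclp.rtrancl_into_rtrancl)
  from st show ?case
  proof cases
    case (stay a)
    with A B C' show ?thesis by blast
  next
    case (push a y)
    \<comment> \<open>The new height records the configuration right after the push; since
      \<open>stay\<close> changes no record, each height keeps its first configuration.\<close>
    let ?n = "Suc (length s1)"
    show ?thesis
    proof (intro exI[of _ "Q(?n := p)"] exI[of _ "U(?n := v)"] conjI allI impI)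
      fix h assume "h \<le> length s"
      then consider "h = ?n" | "h \<le> length s1" using push by fastforce
      then show "wr\<^sup>*\<^sup>* (q, u, []) ((Q(?n := p)) h, (U(?n := v)) h, take h s)"
        by cases (use run A push in auto)
    next
      fix i j assume "i \<le> j" "j \<le> length s"
      then consider "i = ?n" "j = ?n" | "i \<le> length s1" "j = ?n" | "i \<le> length s1" "j \<le> length s1"
        using push by fastforce
      then show "wr\<^sup>*\<^sup>* ((Q(?n := p)) i, (U(?n := v)) i, take i s) ((Q(?n := p)) j, (U(?n := v)) j, take j s)"
        by cases (use B C' push \<open>i \<le> j\<close> in auto)
    next
      fix h assume "h \<le> length s"
      then consider "h = ?n" | "h \<le> length s1" using push by fastforce
      then show "wr\<^sup>*\<^sup>* ((Q(?n := p)) h, (U(?n := v)) h, take h s) (p, v, s)"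
        by cases (use C' push in auto)
    qed
  qed
qed

subsection \<open>The read phase\<close>

lemma rd_mono: "rd S w c c' \<Longrightarrow> S \<subseteq> T \<Longrightarrow> rd T w c c'"
  by (auto elim!: rd.cases intro!: rd.intros)

text \<open>Each consumed letter adds at most one head position to \<open>S\<close>. This bounds the
  places where the read phase cannot be treated as free of input.\<close>

lemma rd_consuming_positions:
  assumes "(rd UNIV w)\<^sup>*\<^sup>* (q, u, k) (p, v, k')"
  shows "\<exists>S. finite S \<and> card S + length v \<le> length u \<and> (rd S w)\<^sup>*\<^sup>* (q, u, k) (p, v, k')"
  using assms
proof (induction "(p, v, k')" arbitrary: p v k')
  case base
  show ?case by (rule exI[of _ "{}"]) (use base in auto)
next
  case (step c)
  from step.hyps(2) show ?case
  proof cases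
    case (1 q' a k1 i)
    from step.hyps(3)[OF 1(1)] obtain S where S: "finite S"
      "card S + length (word_of a @ v) \<le> length u" "(rd S w)\<^sup>*\<^sup>* (q, u, k) (q', word_of a @ v, k1)"
      by blast
    let ?T = "if a = None then S else insert k1 S"
    have "(rd ?T w)\<^sup>*\<^sup>* (q, u, k) (q', word_of a @ v, k1)"
      using S(3) by (rule rtranclp_mono[THEN predicate2D, rotated]) (auto intro: rd_mono)
    moreover have "rd ?T w (q', word_of a @ v, k1) (p, v, k')"
      using 1 by (intro rd.intros) auto
    moreover have "finite ?T" "card ?T + length v \<le> length u"
      using S by (cases a; auto simp: card_insert_if)+
    ultimately show ?thesis by (meson rtranclp.rtrancl_into_rtrancl)
  qed
qed

text \<open>Since \<open>z\<close> occupies tape position \<open>length \<alpha>\<close>, block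
  position \<open>k\<close> is tape position \<open>length \<alpha> + k\<close>. The lower exit is
  then the cell of \<open>z\<close> and the upper exit the first cell of \<open>\<beta>\<close>, so
  both are on the tape.\<close>

lemma rd_lift_lstep:
  assumes "(lstep t)\<^sup>*\<^sup>* (q, k) (p, k')" "v \<in> lists (input_alph M)" "\<beta> \<noteq> []"
  shows "(rd UNIV (\<alpha> @ z # t @ \<beta>))\<^sup>*\<^sup>* (q, v, length \<alpha> + k) (p, v, length \<alpha> + k')"
  using assms(1)
proof (induction "(p, k')" arbitrary: p k')
  case (step c)
  from step.hyps(2) show ?case
  proof cases
    case (1 q' j i)
    have "rd UNIV (\<alpha> @ z # t @ \<beta>) (q', word_of None @ v, length \<alpha> + Suc j) (p, v, length \<alpha> + k')"
      using 1 assms(2,3) by (intro rd.intros; cases \<beta>) (auto simp: shift_def nth_append)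
    with step.hyps(3)[OF 1(1)] show ?thesis by (simp add: rtranclp.rtrancl_into_rtrancl)
  qed
qed auto

text \<open>Each excursion of the head into \<open>t2\<close> enters and leaves through its ends without consuming
  input, so equality of behaviours provides an excursion into \<open>t1\<close> with the same end states.\<close>

lemma rd_replace_block:
  fixes \<alpha> \<beta> t1 t2 :: "'g list" and z :: 'g
  defines "w1 \<equiv> \<alpha> @ z # t1 @ \<beta>" and "w2 \<equiv> \<alpha> @ z # t2 @ \<beta>"
  assumes beh: "beh t1 = beh t2" and ne: "t1 \<noteq> []" "t2 \<noteq> []" "\<beta> \<noteq> []"
    and S: "S \<inter> {length \<alpha> <.. length \<alpha> + length t2} = {}"
    and q: "q \<in> states M"
    and run: "(rd S w2)\<^sup>*\<^sup>* (q, u, k + length t2) (p, v, k')" and k: "length \<alpha> < k"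
    and out: "k' \<notin> {length \<alpha> <.. length \<alpha> + length t2}"
  shows "\<exists>k''. (rd UNIV w1)\<^sup>*\<^sup>* (q, u, k + length t1) (p, v, k'')"
proof -
  define inside where "inside = {length \<alpha> <.. length \<alpha> + length t2}"
  \<comment> \<open>\<open>\<phi>\<close> carries positions outside the block from \<open>w2\<close>
    to \<open>w1\<close>: those below stay, those above move by the difference of the block
    lengths.\<close>
  define \<phi> where "\<phi> k = (if k \<le> length \<alpha> then k else k - length t2 + length t1)" for k
  have pos: "0 < length t1" "0 < length t2" "0 < length \<beta>"
    using ne by auto
  define start where "start = (q, u, k + length t1)"
  \<comment> \<open>Outside the block both runs proceed in parallel. During an excursion the run on
    \<open>w1\<close> waits at the corresponding entry, in the state \<open>q1\<close> of the entry;
    it can wait because the excursion leaves the input \<open>v\<close> unchanged.\<close>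
  have "p \<in> states M \<and>
    (k' \<notin> inside \<longrightarrow> (rd UNIV w1)\<^sup>*\<^sup>* start (p, v, \<phi> k')) \<and>
    (k' \<in> inside \<longrightarrow> (\<exists>d q1. q1 \<in> states M \<and> (rd UNIV w1)\<^sup>*\<^sup>* start (q1, v, length \<alpha> + entry t1 d) \<and>
       (lstep t2)\<^sup>*\<^sup>* (q1, entry t2 d) (p, k' - length \<alpha>)))"
    using run
  proof (induction "(p, v, k')" arbitrary: p v k')
    case base
    then show ?case using q k by (auto simp: inside_def \<phi>_def start_def)
  next
    case (step c)
    from step.hyps(2) show ?case
    proof cases
      case (1 q' a k1 i)
      note IH = step.hyps(3)[OF 1(1)]
      have p: "p \<in> states M" using 1 transition_target by blast
      show ?thesis
      proof (cases "k1 \<in> inside")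
        case False
        with IH have run1: "(rd UNIV w1)\<^sup>*\<^sup>* start (q', word_of a @ v, \<phi> k1)" by blast
        have "w1 ! \<phi> k1 = w2 ! k1"
        proof (cases "k1 \<le> length \<alpha>")
          case True
          then show ?thesis by (auto simp: \<phi>_def w1_def w2_def nth_append)
        next
          case out: False
          with False obtain r where "k1 = length (\<alpha> @ z # t2) + r"
            using that[of "k1 - length \<alpha> - length t2 - 1"] by (simp add: inside_def)
          moreover from this have "\<phi> k1 = length (\<alpha> @ z # t1) + r" by (simp add: \<phi>_def)
          moreover have "w1 = (\<alpha> @ z # t1) @ \<beta>" "w2 = (\<alpha> @ z # t2) @ \<beta>"
            by (simp_all add: w1_def w2_def)
          ultimately show ?thesis by (metis nth_append_length_plus)
        qed
        moreover have "\<phi> k1 < length w1" using False 1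
          by (auto simp: \<phi>_def w1_def w2_def inside_def)
        \<comment> \<open>A move into the block comes from above exactly if
          \<open>length \<alpha> < k1\<close>, which selects the end of \<open>t1\<close> to
          enter.\<close>
        moreover define k2 where "k2 = (if k' \<in> inside then length \<alpha> + entry t1 (length \<alpha> < k1) else \<phi> k')"
        have "shift i (\<phi> k1) k2"
        proof -
          from 1(3) consider "i = Down" "k1 = Suc k'" | "i = Same" "k' = k1" | "i = Up" "k' = Suc k1"
            by (auto simp: shift_def)
          then show ?thesis
            by cases (use False pos in \<open>simp_all add: \<phi>_def k2_def shift_def inside_def entry_def; linarith\<close>)+
        qed
        moreover have "k2 < length w1" using 1(5) pos
          by (simp add: \<phi>_def k2_def w1_def w2_def inside_def entry_def) linarith
        ultimately have "rd UNIV w1 (q', word_of a @ v, \<phi> k1) (p, v, k2)"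
          using 1 by (intro rd.intros) auto
        with run1 have run2: "(rd UNIV w1)\<^sup>*\<^sup>* start (p, v, k2)" by (rule rtranclp.rtrancl_into_rtrancl)
        have "k' - length \<alpha> = entry t2 (length \<alpha> < k1)" if "k' \<in> inside"
          using that False 1(3) by (auto simp: shift_def inside_def entry_def)
        then have "\<exists>d q1. q1 \<in> states M \<and> (rd UNIV w1)\<^sup>*\<^sup>* start (q1, v, length \<alpha> + entry t1 d) \<and>
            (lstep t2)\<^sup>*\<^sup>* (q1, entry t2 d) (p, k' - length \<alpha>)" if "k' \<in> inside"
          using run2 p that unfolding k2_def
          by (intro exI[of _ "length \<alpha> < k1"] exI[of _ p]) simp
        moreover have "(rd UNIV w1)\<^sup>*\<^sup>* start (p, v, \<phi> k')" if "k' \<notin> inside"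
          using run2 that unfolding k2_def by simp
        ultimately show ?thesis using p by blast
      next
        case True
        then have a: "a = None" using 1 S by (auto simp: inside_def)
        from True IH a obtain d q1 where d: "q1 \<in> states M"
          "(rd UNIV w1)\<^sup>*\<^sup>* start (q1, v, length \<alpha> + entry t1 d)"
          "(lstep t2)\<^sup>*\<^sup>* (q1, entry t2 d) (q', k1 - length \<alpha>)" by auto
        obtain j where j: "k1 = length \<alpha> + Suc j" "j < length t2"
          using True that[of "k1 - length \<alpha> - 1"] by (simp add: inside_def) linarith
        have k': "shift i (Suc j) (k' - length \<alpha>)" "length \<alpha> \<le> k'"
          using 1(3) j by (auto simp: shift_def)
        have "lstep t2 (q', Suc j) (p, k' - length \<alpha>)"
          using 1 j k' a by (intro lstep.intros) (auto simp: w2_def nth_append)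
        with d(3) j have l: "(lstep t2)\<^sup>*\<^sup>* (q1, entry t2 d) (p, k' - length \<alpha>)"
          by (simp add: rtranclp.rtrancl_into_rtrancl)
        show ?thesis
        proof (cases "k' \<in> inside")
          case True
          with d l p show ?thesis by blast
        next
          case False
          \<comment> \<open>The excursion ends here, and \<open>d'\<close> is the side on which it
            leaves. Only now does the run on \<open>w1\<close> catch up, by the equality of
            behaviours.\<close>
          define d' where "d' \<longleftrightarrow> length \<alpha> < k'"
          have e: "k' - length \<alpha> = exit t2 d'" "\<phi> k' = length \<alpha> + exit t1 d'"
            using False k' j by (auto simp: shift_def inside_def exit_def d'_def \<phi>_def)
          with l d(1) have "(d, q1, d', p) \<in> beh t2" by (auto simp: beh_def)
          then have "(d, q1, d', p) \<in> beh t1" using beh by simp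
          then have "(lstep t1)\<^sup>*\<^sup>* (q1, entry t1 d) (p, exit t1 d')" by (simp add: beh_def)
          from rd_lift_lstep[OF this _ ne(3), of v \<alpha> z] 1(6) d(2)
          have "(rd UNIV w1)\<^sup>*\<^sup>* start (p, v, \<phi> k')" unfolding e w1_def by (meson rtranclp_trans)
          with False p show ?thesis by blast
        qed
      qed
    qed
  qed
  with out show ?thesis unfolding inside_def start_def by blast
qed

subsection \<open>Cutting the stack\<close>

text \<open>Position 0 is the bottom marker, so reading starts at position \<open>length s\<close>,
  the top of the written word.\<close>

definition acc :: "'a list \<Rightarrow> 'g list \<Rightarrow> bool" where
  "acc u s \<longleftrightarrow> (\<exists>q v p k. wr\<^sup>*\<^sup>* (init_state M, u, []) (q, v, s) \<and>
     (rd UNIV (bottom M # s @ [top_mark M]))\<^sup>*\<^sup>* (q, v, length s) (p, [], k) \<and>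
     p \<in> final_states M)"

definition colours :: "('q \<times> 'g \<times> (bool \<times> 'q \<times> bool \<times> 'q) set) set" where
  "colours = states M \<times> stack_alph M \<times> Pow (UNIV \<times> states M \<times> UNIV \<times> states M)"

lemma finite_colours: "finite colours"
  using sa by (simp add: colours_def stack_automaton_def)

lemma acc_cut:
  assumes "acc u s" and large: "Suc (card colours) * (length u + 3) \<le> length s"
  shows "\<exists>s'. length s' < length s \<and> acc u s'"
proof -
  let ?q0 = "init_state M" and ?b = "bottom M" and ?t = "top_mark M" and ?m = "length s"
  from assms(1) obtain q v p kf where
    writing: "wr\<^sup>*\<^sup>* (?q0, u, []) (q, v, s)" and
    "(rd UNIV (?b # s @ [?t]))\<^sup>*\<^sup>* (q, v, ?m) (p, [], kf)" and final: "p \<in> final_states M"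
    unfolding acc_def by blast
  from rd_consuming_positions[OF this(2)] obtain S where finS: "finite S" and cardS: "card S \<le> length v"
    and reading: "(rd S (?b # s @ [?t]))\<^sup>*\<^sup>* (q, v, ?m) (p, [], kf)" by auto
  from wr_heights[OF writing] obtain Q U where
    pre: "\<And>h. h \<le> ?m \<Longrightarrow> wr\<^sup>*\<^sup>* (?q0, u, []) (Q h, U h, take h s)" and
    mid: "\<And>i j. i \<le> j \<Longrightarrow> j \<le> ?m \<Longrightarrow> wr\<^sup>*\<^sup>* (Q i, U i, take i s) (Q j, U j, take j s)" and
    post: "\<And>h. h \<le> ?m \<Longrightarrow> wr\<^sup>*\<^sup>* (Q h, U h, take h s) (q, v, s)" by blast
  have q0: "?q0 \<in> states M" using sa by (simp add: stack_automaton_def)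
  have inner: "set s \<subseteq> inner_alph M" using wr_invariants(3)[OF writing] by simp
  define T where "T = insert kf (insert ?m S)"
  have finT: "finite T" using finS by (simp add: T_def)
  have cardT: "card T \<le> length v + 2"
    using finS cardS by (auto simp: T_def card_insert_if)
  \<comment> \<open>Both summands grow with \<open>h\<close>: special positions up to
    \<open>h\<close>, and letters consumed before height \<open>h\<close>. Letters consumed in
    writing are lost to reading, so both share one budget and \<open>g\<close> takes at most
    \<open>length u + 3\<close> values.\<close>
  define g where "g h = card {x \<in> T. x \<le> h} + (length u - length (U h))" for h
  have "g h \<le> length u + 2" if "h \<le> ?m" for h
  proof -
    have "card {x \<in> T. x \<le> h} \<le> card T" using finT by (auto intro: card_mono)
    moreover have "length v \<le> length (U h)" "length (U h) \<le> length u"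
      using wr_invariants(1)[OF post[OF that]] wr_invariants(1)[OF pre[OF that]] by auto
    ultimately show ?thesis using cardT by (simp add: g_def)
  qed
  then have "g \<in> {..?m} \<rightarrow> {..length u + 2}" by auto
  from pigeonhole_card[OF this] obtain y where
    "card {..?m} \<le> card (g -` {y} \<inter> {..?m}) * card {..length u + 2}" by blast
  then have "Suc ?m \<le> card (g -` {y} \<inter> {..?m}) * (length u + 3)"
    by (simp add: numeral_3_eq_3)
  define H where "H = g -` {y} \<inter> {..?m}"
  have finH: "finite H" by (simp add: H_def)
  \<comment> \<open>There are \<open>Suc ?m\<close> heights, which makes the inequality strict. The
    successor in \<open>Suc (card colours)\<close> pays for discarding one height below.\<close>
  have "Suc (card colours) * (length u + 3) < card H * (length u + 3)"
    using large \<open>Suc ?m \<le> _\<close> unfolding H_def by linarith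
  then have cardH: "Suc (card colours) < card H" by (metis mult_less_cancel2)
  then have "H \<noteq> {}" by auto
  \<comment> \<open>All blocks start above the least height \<open>a\<close> of the class.
    Discarding \<open>a\<close> itself makes them nonempty, as the exchange of blocks
    requires.\<close>
  define a where "a = Min H"
  have aH: "a \<in> H" and a_le: "\<And>h. h \<in> H \<Longrightarrow> a \<le> h"
    using finH \<open>H \<noteq> {}\<close> by (auto simp: a_def)
  define col where "col h = (Q h, last (?b # take h s), beh (drop a (take h s)))" for h
  have "col ` (H - {a}) \<subseteq> colours"
  proof (rule image_subsetI)
    fix h assume "h \<in> H - {a}"
    then have h: "h \<le> ?m" by (simp add: H_def)
    have "Q h \<in> states M" using wr_invariants(2)[OF pre[OF h]] q0 by simp
    moreover have "last (?b # take h s) \<in> stack_alph M"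
    proof (cases "take h s = []")
      case True
      then show ?thesis using sa by (auto simp: stack_automaton_def)
    next
      case False
      then have "last (take h s) \<in> set s" by (meson in_set_takeD last_in_set)
      with False inner show ?thesis by (auto simp: inner_alph_def)
    qed
    ultimately show "col h \<in> colours" using beh_subset by (auto simp: col_def colours_def)
  qed
  then have "card (col ` (H - {a})) \<le> card colours" by (rule card_mono[OF finite_colours])
  also have "\<dots> < card (H - {a})" using cardH aH finH by simp
  finally have "\<not> inj_on col (H - {a})" by (rule pigeonhole)
  then obtain i j where ij: "i \<in> H" "j \<in> H" "i \<noteq> a" "i < j" "col i = col j"
    unfolding inj_on_def by (metis DiffE insertI1 linorder_neqE_nat)
  then have ai: "a < i" using a_le[of i] by simp
  have jm: "j \<le> ?m" and im: "i \<le> ?m" and am: "a \<le> ?m" using ij aH by (auto simp: H_def)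
  have geq: "g a = g i" "g i = g j" using ij aH by (auto simp: H_def)
  have cards: "card {x \<in> T. x \<le> h} \<le> card {x \<in> T. x \<le> h'}" if "h \<le> h'" for h h'
    using finT that by (intro card_mono) auto
  have lens: "length (U h') \<le> length (U h)" "length (U h) \<le> length u" if "h \<le> h'" "h' \<le> ?m" for h h'
    using wr_invariants(1)[OF mid[OF that]] wr_invariants(1)[OF pre[of h]] that by auto
  \<comment> \<open>A constant sum of two monotone summands has constant summands: no special
    position lies in the stretch and, below, no letter is consumed while it is written.\<close>
  have "card {x \<in> T. x \<le> a} = card {x \<in> T. x \<le> j}"
    using geq cards[of a i] cards[of i j] lens[of a i] lens[of i j] ai ij(4) jm im unfolding g_def by linarith
  then have T_eq: "{x \<in> T. x \<le> a} = {x \<in> T. x \<le> j}"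
    using finT ai ij(4) by (intro card_subset_eq) auto
  have noT: "x \<notin> T" if "a < x" "x \<le> j" for x
  proof
    assume "x \<in> T"
    then have "x \<in> {x \<in> T. x \<le> a}" unfolding T_eq using that by simp
    then show False using that by simp
  qed
  have "length (U i) = length (U j)"
    using geq(2) cards[of i j] lens[of i j] ij(4) jm unfolding g_def by linarith
  then have Uij: "U i = U j" using wr_invariants(1)[OF mid[of i j]] ij(4) jm by auto
  have Qij: "Q i = Q j" and lastij: "last (?b # take i s) = last (?b # take j s)"
    and behij: "beh (drop a (take i s)) = beh (drop a (take j s))"
    using ij(5) by (auto simp: col_def)
  \<comment> \<open>The starting position \<open>?m\<close> of the read phase is special, hence lies
    above the stretch.\<close>
  have "j < ?m" using noT[of ?m] ai ij(4) jm by (fastforce simp: T_def)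
  define s' where "s' = take i s @ drop j s"
  \<comment> \<open>State, remaining input and top symbol agree at heights \<open>i\<close> and
    \<open>j\<close>, so what was written above \<open>j\<close> can be written above
    \<open>i\<close>.\<close>
  have "wr\<^sup>*\<^sup>* (Q i, U i, take i s) (q, v, s')"
  proof -
    from wr_append[OF post[OF jm]] obtain d where "s = take j s @ d"
      "wr\<^sup>*\<^sup>* (Q j, U j, take i s) (q, v, take i s @ d)" using lastij by blast
    moreover from this(1) have "d = drop j s" by (metis append_take_drop_id same_append_eq)
    ultimately show ?thesis using Qij Uij by (simp add: s'_def)
  qed
  with pre[OF im] have writing': "wr\<^sup>*\<^sup>* (?q0, u, []) (q, v, s')" by (rule rtranclp_trans)
  \<comment> \<open>The cell \<open>z\<close> at tape position \<open>a\<close> is the lower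
    neighbour of the block; it is the bottom marker if \<open>a = 0\<close>. The top marker keeps
    \<open>\<beta>\<close> nonempty.\<close>
  define \<alpha> where "\<alpha> = butlast (?b # take a s)"
  define z where "z = last (?b # take a s)"
  define \<beta> where "\<beta> = drop j s @ [?t]"
  have \<alpha>z: "\<alpha> @ z # r = ?b # take a s @ r" for r
    using append_butlast_last_id[of "?b # take a s"] unfolding \<alpha>_def z_def
    by (metis append.assoc append_Cons append_Nil list.distinct(1))
  have len\<alpha>: "length \<alpha> = a" using am by (auto simp: \<alpha>_def)
  have split: "take a s @ drop a (take h s) = take h s" if "a \<le> h" for h
    by (metis append_take_drop_id min.absorb1 take_take that)
  have w2: "\<alpha> @ z # drop a (take j s) @ \<beta> = ?b # s @ [?t]"
    using split[of j] ai ij(4) unfolding \<alpha>z \<beta>_def by (simp flip: append_assoc)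
  have w1: "\<alpha> @ z # drop a (take i s) @ \<beta> = ?b # s' @ [?t]"
    using split[of i] ai unfolding \<alpha>z \<beta>_def s'_def by (simp flip: append_assoc)
  \<comment> \<open>The start \<open>?m\<close> is written as \<open>?m - (j - a)\<close> plus the
    block length; the first summand exceeds \<open>a\<close> because \<open>j < ?m\<close>.\<close>
  have "\<exists>k''. (rd UNIV (\<alpha> @ z # drop a (take i s) @ \<beta>))\<^sup>*\<^sup>*
      (q, v, (?m - (j - a)) + length (drop a (take i s))) (p, [], k'')"
  proof (rule rd_replace_block[OF behij])
    show "q \<in> states M" using wr_invariants(2)[OF writing] q0 by simp
    show "(rd S (\<alpha> @ z # drop a (take j s) @ \<beta>))\<^sup>*\<^sup>*
      (q, v, (?m - (j - a)) + length (drop a (take j s))) (p, [], kf)"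
      unfolding w2 using reading ai ij(4) jm by simp
  qed (use noT ai ij(4) im jm \<open>j < ?m\<close> in \<open>auto simp: len\<alpha> \<beta>_def T_def\<close>)
  moreover have "(?m - (j - a)) + length (drop a (take i s)) = length s'"
    using ai ij(4) im jm by (simp add: s'_def)
  ultimately have "acc u s'" using writing' final unfolding acc_def w1 by auto
  moreover have "length s' < ?m" using ij(4) jm by (simp add: s'_def)
  ultimately show ?thesis by blast
qed

subsection \<open>Computations\<close>

lemma write_step_wr:
  assumes "write_step M (q, u, bottom M # s, [top_mark M]) c"
  shows "\<exists>p v s'. c = (p, v, bottom M # s', [top_mark M]) \<and> wr (q, u, s) (p, v, s')"
  using assms
proof cases
  case (stay a x p v \<gamma>)
  then have "last (bottom M # s) = x" by (metis last_snoc)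
  with stay wr.stay[of q a s p v] show ?thesis by (intro exI[of _ p] exI[of _ v] exI[of _ s]) simp
next
  case (push a x p y v \<gamma>)
  then have "last (bottom M # s) = x" by (metis last_snoc)
  moreover have "\<gamma> @ [x, y] = bottom M # s @ [y]"
    using arg_cong[OF push(2), of "\<lambda>l. l @ [y]"] by simp
  ultimately show ?thesis using push wr.push[of q a s p y v]
    by (intro exI[of _ p] exI[of _ v] exI[of _ "s @ [y]"]) simp
qed (use no_pop in blast)

lemma wr_write_step:
  assumes "wr (q, u, s) (p, v, s')" "set s \<subseteq> inner_alph M"
  shows "write_step M (q, u, bottom M # s, [top_mark M]) (p, v, bottom M # s', [top_mark M])"
proof -
  define \<gamma> x where "\<gamma> = butlast (bottom M # s)" and "x = last (bottom M # s)"
  have s: "bottom M # s = \<gamma> @ [x]" unfolding \<gamma>_def x_def by (metis append_butlast_last_id list.distinct(1))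
  then have st: "\<gamma> @ [x, top_mark M] \<in> stacks M" using stacks_iff[of s] assms(2)
    by (metis append.assoc append_Cons append_Nil)
  have x: "x \<in> inner_alph M \<union> {bottom M}"
    using subsetD[OF assms(2) last_in_set] by (auto simp: x_def)
  from assms(1) show ?thesis
  proof cases
    case (stay a)
    with write_step.stay[of M q a x p v \<gamma>] st x show ?thesis by (simp add: s flip: x_def)
  next
    case (push a y)
    have e: "bottom M # s @ [y] = \<gamma> @ [x, y]" using arg_cong[OF s, of "\<lambda>l. l @ [y]"] by simp
    from push write_step.push[of M q a x p y v \<gamma>] st x show ?thesis by (simp add: s e flip: x_def)
  qed
qed

lemma read_step_rd:
  assumes "read_step M (q, u, l, r) c" "l \<noteq> []" "l @ r \<in> stacks M"
  shows "\<exists>p v l' r'. c = (p, v, l', r') \<and> l' \<noteq> [] \<and> l' @ r' = l @ r \<and>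
    rd UNIV (l @ r) (q, u, length l - 1) (p, v, length l' - 1)"
  using assms(1)
proof cases
  case (down a x p v \<gamma>)
  \<comment> \<open>Otherwise the scanned symbol would be the bottom marker, where
    \<open>Down\<close> is excluded.\<close>
  have "\<gamma> \<noteq> []" using down assms(3) by (auto simp: stacks_def)
  with down show ?thesis by (auto intro!: rd.intros simp: shift_def)
next
  case (same a x p v \<gamma>)
  then show ?thesis by (auto intro!: rd.intros simp: shift_def)
next
  case (up a x p v \<gamma> y \<gamma>')
  then show ?thesis by (auto intro!: rd.intros simp: shift_def)
qed

lemma rd_read_step:
  assumes "rd UNIV w (q, u, k) (p, v, k')" "w \<in> stacks M"
  shows "read_step M (q, u, take (Suc k) w, drop (Suc k) w) (p, v, take (Suc k') w, drop (Suc k') w)"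
  using assms(1)
proof cases
  case (1 a i)
  have tk: "take (Suc k) w = take k w @ [w ! k]" using 1 by (simp add: take_Suc_conv_app_nth)
  have dr: "drop k w = w ! k # drop (Suc k) w" using 1 by (simp add: Cons_nth_drop_Suc)
  have w: "take k w @ [w ! k] @ drop (Suc k) w \<in> stacks M"
    using assms(2) 1 by (simp add: id_take_nth_drop[symmetric])
  from 1(3) consider "i = Down" "k = Suc k'" | "i = Same" "k' = k" | "i = Up" "k' = Suc k"
    by (auto simp: shift_def)
  then show ?thesis
  proof cases
    case a: 1
    \<comment> \<open>In \<open>rd\<close> the ban on \<open>Down\<close> at the bottom is implicit
      in \<open>k = Suc k'\<close>: the bottom marker occurs at position 0 only.\<close>
    have "w ! k \<noteq> bottom M"
    proof -
      from assms(2) obtain s where s: "w = bottom M # s @ [top_mark M]" "set s \<subseteq> inner_alph M"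
        by (auto simp: stacks_def)
      then have "w ! k \<in> set (s @ [top_mark M])"
        using a 1(4) nth_mem[of k' "s @ [top_mark M]"] by simp
      with s show ?thesis by auto
    qed
    with read_step.down[of M q a "w ! k" p v "take k w" "drop (Suc k) w"] 1 a w show ?thesis
      using tk dr by simp
  next
    case 2
    with read_step.same[of M q a "w ! k" p v "take k w" "drop (Suc k) w"] 1 w show ?thesis
      using tk by simp
  next
    case 3
    then have k: "Suc k < length w" using 1 by simp
    then have d: "drop (Suc k) w = w ! Suc k # drop (Suc (Suc k)) w" by (simp add: Cons_nth_drop_Suc)
    have t: "take (Suc (Suc k)) w = take k w @ [w ! k, w ! Suc k]"
      using k tk by (simp add: take_Suc_conv_app_nth)
    from read_step.up[of M q a "w ! k" p v "take k w" "w ! Suc k" "drop (Suc (Suc k)) w"] 1 3 w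
    show ?thesis using tk d t by simp
  qed
qed

text \<open>A read state never leads to a write state, so no write step can follow a read
  step.\<close>

lemma step_phases:
  assumes "(step M)\<^sup>*\<^sup>* c0 c"
  shows "\<exists>c1. (write_step M)\<^sup>*\<^sup>* c0 c1 \<and> (read_step M)\<^sup>*\<^sup>* c1 c"
proof -
  obtain Qw Qr where part: "partitioned_by M Qw Qr"
    and sep: "\<forall>q a y p i. transition M q a y p i \<longrightarrow> q \<in> Qr \<longrightarrow> p \<notin> Qw"
    using csa unfolding checking_stack_automaton_def by blast
  have wQ: "fst c \<in> Qw" if "write_step M c c'" for c c'
    using that
  proof cases
    case (stay q a x p) then show ?thesis using part by (fastforce simp: partitioned_by_def transition_def)
  next
    case (push q a x p) then show ?thesis using part by (fastforce simp: partitioned_by_def transition_def)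
  next
    case (pop q a x p) then show ?thesis using no_pop by blast
  qed
  have sep': "p \<notin> Qw" if "transition M q a y p i" "i \<in> {Down, Same, Up}" for q a y p i
  proof -
    have "q \<in> Qr" using that part by (fastforce simp: partitioned_by_def transition_def)
    with sep that(1) show ?thesis by blast
  qed
  have rQ: "fst c' \<notin> Qw" if "read_step M c c'" for c c'
    using that by cases (use sep' in auto)
  \<comment> \<open>The added conjunct says that no read step has occurred while the state is a
    write state; this lets a further write step extend the first phase.\<close>
  have "\<exists>c1. (write_step M)\<^sup>*\<^sup>* c0 c1 \<and> (read_step M)\<^sup>*\<^sup>* c1 c \<and> (fst c \<in> Qw \<longrightarrow> c1 = c)"
    using assms
  proof induction
    case (step c c')
    then show ?case
      by (metis wQ rQ step_def rtranclp.rtrancl_into_rtrancl rtranclp.rtrancl_refl)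
  qed blast
  then show ?thesis by blast
qed

text \<open>Without \<open>Pop\<close> the stack never shrinks; hence the size of a computation is
  that of its last configuration.\<close>

lemma step_configs:
  assumes "step M c c'" "c \<in> configs M"
  shows "c' \<in> configs M" "stack_size c \<le> stack_size c'"
proof -
  have "c' \<in> configs M \<and> stack_size c \<le> stack_size c'"
    using assms(1) unfolding step_def
  proof
    assume "write_step M c c'"
    then show ?thesis
    proof cases
      case (push q a x p y u \<gamma>)
      from push(6) obtain s where s: "\<gamma> @ [x] = bottom M # s" "set s \<subseteq> inner_alph M"
        unfolding stacks_def by (auto simp: append_eq_Cons_conv)
      have "y \<in> inner_alph M" using transition_target(2)[OF push(3)] by (auto simp: instrs_def)
      then have "(\<gamma> @ [x]) @ [y, top_mark M] \<in> stacks M"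
        unfolding s using stacks_iff[of "s @ [y]"] s by simp
      with push transition_target show ?thesis by (auto simp: configs_def)
    qed (use no_pop transition_target in \<open>auto simp: configs_def\<close>)
  next
    assume r: "read_step M c c'"
    obtain q u l r where c: "c = (q, u, l, r)" by (cases c)
    from read_step_rd[OF r[unfolded c]] assms(2) c obtain p v l' r' where
      c': "c' = (p, v, l', r')" "l' \<noteq> []" "l' @ r' = l @ r"
      "rd UNIV (l @ r) (q, u, length l - 1) (p, v, length l' - 1)"
      by (auto simp: configs_def)
    from c'(4) have "p \<in> states M" "v \<in> lists (input_alph M)"
      by (auto elim!: rd.cases dest: transition_target)
    moreover have "length l' + length r' = length l + length r"
      using c'(3) by (metis length_append)
    ultimately show ?thesis using c c' assms(2) by (auto simp: configs_def)
  qed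
  then show "c' \<in> configs M" "stack_size c \<le> stack_size c'" by auto
qed

lemma successively_step:
  assumes "successively (step M) C" "C \<noteq> []" "set C \<subseteq> configs M"
  shows "(step M)\<^sup>*\<^sup>* (hd C) (last C)" "\<forall>c \<in> set C. stack_size c \<le> stack_size (last C)"
proof -
  have "(step M)\<^sup>*\<^sup>* (hd C) (last C) \<and> (\<forall>c \<in> set C. stack_size c \<le> stack_size (last C))"
    using assms
  proof (induction C rule: induct_list012)
    case (3 c c' C)
    then have "step M c c'" "stack_size c \<le> stack_size c'" by (auto intro: step_configs)
    with 3 show ?case by (fastforce intro: converse_rtranclp_into_rtranclp)
  qed auto
  then show "(step M)\<^sup>*\<^sup>* (hd C) (last C)" "\<forall>c \<in> set C. stack_size c \<le> stack_size (last C)" by auto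
qed

lemma steps_successively:
  assumes "(step M)\<^sup>*\<^sup>* c c'" "c \<in> configs M"
  shows "\<exists>C. C \<noteq> [] \<and> set C \<subseteq> configs M \<and> hd C = c \<and> last C = c' \<and> successively (step M) C"
  using assms(1)
proof induction
  case base
  show ?case by (rule exI[of _ "[c]"]) (use assms(2) in auto)
next
  case (step c1 c2)
  then obtain C where C: "C \<noteq> []" "set C \<subseteq> configs M" "hd C = c" "last C = c1" "successively (step M) C"
    by blast
  then have "c2 \<in> configs M" using step step_configs by (metis last_in_set subsetD)
  with C step(2) show ?case
    by (intro exI[of _ "C @ [c2]"]) (auto simp: successively_append_iff)
qed

lemma computation_size_eq:
  assumes "accepting_computation M u C"
  shows "computation_size C = stack_size (last C)"
  unfolding computation_size_def
  using assms successively_step(2)[of C]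
  by (intro Max_eqI) (auto simp: accepting_computation_def computation_def partial_computation_def)

text \<open>Splitting a computation into its phases yields the word \<open>s\<close>, and gluing two
  such phases yields a computation. Reading does not change the stack, so the size is
  \<open>length s\<close>.\<close>

lemma acc_iff:
  assumes "u \<in> lists (input_alph M)"
  shows "(\<exists>C. accepting_computation M u C \<and> m = computation_size C) \<longleftrightarrow> (\<exists>s. acc u s \<and> length s = m)"
    (is "?L \<longleftrightarrow> ?R")
proof
  let ?b = "bottom M" and ?t = "top_mark M"
  assume ?L
  then obtain C where C: "accepting_computation M u C" "m = stack_size (last C)"
    using computation_size_eq by auto
  then have "(step M)\<^sup>*\<^sup>* (init_state M, u, [?b], [?t]) (last C)"
    using successively_step(1)[of C]
    by (auto simp: accepting_computation_def computation_def partial_computation_def)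
  from step_phases[OF this] obtain c1 where
    w: "(write_step M)\<^sup>*\<^sup>* (init_state M, u, [?b], [?t]) c1" and r: "(read_step M)\<^sup>*\<^sup>* c1 (last C)" by blast
  from w have "\<exists>q v s. c1 = (q, v, ?b # s, [?t]) \<and> wr\<^sup>*\<^sup>* (init_state M, u, []) (q, v, s)"
  proof induction
    case (step c c')
    then obtain q v s where c: "c = (q, v, ?b # s, [?t])" "wr\<^sup>*\<^sup>* (init_state M, u, []) (q, v, s)"
      by blast
    from write_step_wr[OF step(2)[unfolded c(1)]] c(2) show ?case
      by (blast intro: rtranclp.rtrancl_into_rtrancl)
  qed auto
  then obtain q v s where c1: "c1 = (q, v, ?b # s, [?t])" and w': "wr\<^sup>*\<^sup>* (init_state M, u, []) (q, v, s)"
    by blast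
  let ?w = "?b # s @ [?t]"
  have st: "?w \<in> stacks M" using wr_invariants(3)[OF w'] stacks_iff by simp
  from r have "\<exists>p v' l r. last C = (p, v', l, r) \<and> l \<noteq> [] \<and> l @ r = ?w \<and>
    (rd UNIV ?w)\<^sup>*\<^sup>* (q, v, length s) (p, v', length l - 1)"
  proof induction
    case base
    then show ?case by (simp add: c1)
  next
    case (step c c')
    then obtain p v' l r where c: "c = (p, v', l, r)" "l \<noteq> []" "l @ r = ?w"
      "(rd UNIV ?w)\<^sup>*\<^sup>* (q, v, length s) (p, v', length l - 1)" by blast
    from read_step_rd[OF step(2)[unfolded c(1)] c(2)] c(3) st obtain p2 v2 l2 r2 where
      c': "c' = (p2, v2, l2, r2)" "l2 \<noteq> []" "l2 @ r2 = ?w"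
      "rd UNIV ?w (p, v', length l - 1) (p2, v2, length l2 - 1)" by auto
    from c(4) c'(4) have "(rd UNIV ?w)\<^sup>*\<^sup>* (q, v, length s) (p2, v2, length l2 - 1)"
      by (rule rtranclp.rtrancl_into_rtrancl)
    with c'(1-3) show ?case by blast
  qed
  then obtain p v' l r where l: "last C = (p, v', l, r)" "l @ r = ?w"
    "(rd UNIV ?w)\<^sup>*\<^sup>* (q, v, length s) (p, v', length l - 1)" by blast
  have "v' = []" "p \<in> final_states M"
    using C(1) l(1) by (auto simp: accepting_computation_def computation_def)
  then have "acc u s" using w' l(3) unfolding acc_def by blast
  \<comment> \<open>The two markers account for the 2 that \<open>stack_size\<close>
    subtracts.\<close>
  moreover have "length l + length r = length s + 2"
    using arg_cong[OF l(2), of length] by simp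
  ultimately show ?R using C(2) l(1) by auto
next
  let ?b = "bottom M" and ?t = "top_mark M" and ?c0 = "(init_state M, u, [bottom M], [top_mark M])"
  assume ?R
  then obtain s q v p k where s: "length s = m" "wr\<^sup>*\<^sup>* (init_state M, u, []) (q, v, s)"
    "(rd UNIV (?b # s @ [?t]))\<^sup>*\<^sup>* (q, v, length s) (p, [], k)" "p \<in> final_states M"
    unfolding acc_def by blast
  let ?w = "?b # s @ [?t]"
  have st: "?w \<in> stacks M" using wr_invariants(3)[OF s(2)] stacks_iff by simp
  have "(step M)\<^sup>*\<^sup>* ?c0 (q, v, ?b # s, [?t])"
    using s(2)
  proof (induction "(q, v, s)" arbitrary: q v s)
    case (step c)
    obtain q1 v1 s1 where c: "c = (q1, v1, s1)" by (cases c)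
    have "set s1 \<subseteq> inner_alph M" using wr_invariants(3)[OF step(1)[unfolded c]] by simp
    from wr_write_step[OF step(2)[unfolded c] this]
    have "step M (q1, v1, ?b # s1, [?t]) (q, v, ?b # s, [?t])" by (simp add: step_def)
    with step(3)[OF c] show ?case by (rule rtranclp.rtrancl_into_rtrancl)
  qed auto
  moreover have "(step M)\<^sup>*\<^sup>* (q, v, take (Suc (length s)) ?w, drop (Suc (length s)) ?w)
      (p, v', take (Suc k) ?w, drop (Suc k) ?w)"
    if "(rd UNIV ?w)\<^sup>*\<^sup>* (q, v, length s) (p, v', k)" for p v' k
    using that
  proof (induction "(p, v', k)" arbitrary: p v' k)
    case (step c)
    obtain q1 v1 k1 where c: "c = (q1, v1, k1)" by (cases c)
    from rd_read_step[OF step(2)[unfolded c] st]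
    have "step M (q1, v1, take (Suc k1) ?w, drop (Suc k1) ?w) (p, v', take (Suc k) ?w, drop (Suc k) ?w)"
      by (simp add: step_def)
    with step(3)[OF c] show ?case by (rule rtranclp.rtrancl_into_rtrancl)
  qed auto
  note this[OF s(3)]
  ultimately have "(step M)\<^sup>*\<^sup>* ?c0 (p, [], take (Suc k) ?w, drop (Suc k) ?w)" by simp
  moreover have "?c0 \<in> configs M"
    using assms sa stacks_iff[of "[]"] by (auto simp: configs_def stack_automaton_def)
  ultimately obtain C where C: "C \<noteq> []" "set C \<subseteq> configs M" "hd C = ?c0"
    "last C = (p, [], take (Suc k) ?w, drop (Suc k) ?w)" "successively (step M) C"
    using steps_successively by blast
  then have "accepting_computation M u C"
    using s(4) by (simp add: accepting_computation_def computation_def partial_computation_def)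
  moreover have "stack_size (last C) = m"
    unfolding C(4) using s(1) by simp
  ultimately show ?L using computation_size_eq by metis
qed

section \<open>The linear bound\<close>

lemma weak_space_word_le:
  assumes "u \<in> lists (input_alph M)"
  shows "weak_space_word M u \<le> Suc (card colours) * (length u + 3)"
proof (cases "u \<in> lang M")
  case True
  let ?P = "\<lambda>m. \<exists>s. acc u s \<and> length s = m"
  have eq: "weak_space_word M u = (LEAST m. ?P m)"
    using True by (simp add: weak_space_word_def acc_iff[OF assms])
  from True have "\<exists>m. ?P m" unfolding lang_def acc_iff[OF assms, symmetric] by blast
  then obtain s where s: "acc u s" "length s = (LEAST m. ?P m)" using LeastI_ex[of ?P] by blast
  show ?thesis
  proof (rule ccontr)
    assume "\<not> ?thesis"
    then have "Suc (card colours) * (length u + 3) \<le> length s" using eq s(2) by simp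
    \<comment> \<open>A shortest accepted stack word admits no cut.\<close>
    from acc_cut[OF s(1) this] obtain s' where "length s' < length s" "acc u s'" by blast
    then show False using s(2) not_less_Least[of "length s'" ?P] by auto
  qed
qed (simp add: weak_space_word_def)

lemma weak_space_le: "weak_space M n \<le> Suc (card colours) * (n + 3)"
proof (cases "{u \<in> lists (input_alph M). length u = n} = {}")
  \<comment> \<open>With no word of length \<open>n\<close> the supremum in \<open>nat\<close> is
    0.\<close>
  case True
  then show ?thesis unfolding weak_space_def True by simp
next
  case False
  then show ?thesis unfolding weak_space_def
    by (rule cSUP_least) (use weak_space_word_le in auto)
qed

end

theorem proposition3:
  fixes M :: "('q, 'a, 'g) sa"
  assumes "checking_stack_automaton M"
  shows "(\<lambda>n. real (weak_space M n)) \<in> O(\<lambda>n. real n)"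
proof -
  interpret csa M by unfold_locales (rule assms)
  \<comment> \<open>The factor 4 comes from \<open>n + 3 \<le> 4 * n\<close> for
    \<open>n \<ge> 1\<close>.\<close>
  have "real (weak_space M n) \<le> real (4 * Suc (card colours)) * real n" if "1 \<le> n" for n
  proof -
    have "weak_space M n \<le> Suc (card colours) * (4 * n)"
      using that by (intro order_trans[OF weak_space_le] mult_le_mono2) simp
    then show ?thesis by (metis mult.assoc mult.commute of_nat_le_iff of_nat_mult)
  qed
  then show ?thesis
    by (intro bigoI[of _ "real (4 * Suc (card colours))"] eventually_sequentiallyI[of 1]) simp
qed

end
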